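(* Let $k, r, d_1,\dots,d_k$ be positive integers and let $A\in\mathbb{R}^{d_1\times\dots\times d_k}$ be a nonnegative tensor (all entries are $\ge 0$). Then the infimum $$\inf\Bigl\{\Bigl\lVert A-\sum_{p=1}^{r}\delta_p\,\mathbf{u}_p\otimes\mathbf{v}_p\otimes\dots\otimes\mathbf{z}_p\Bigr\rVert_E \Bigm| \boldsymbol{\delta}=(\delta_1,\dots,\delta_r)\in\mathbb{R}_+^r,\ \mathbf{u}_p\in\Delta^{d_1-1},\ \mathbf{v}_p\in\Delta^{d_2-1},\dots,\ \mathbf{z}_p\in\Delta^{d_k-1},\ p=1,\dots,r\Bigr\}$$ is attained, i.e. there is a choice of $\boldsymbol{\delta}$ and $\mathbf{u}_p,\mathbf{v}_p,\dots,\mathbf{z}_p$ ($p=1,\dots,r$) in the indicated sets at which the infimum is achieved.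
   Context: A tensor is a hypermatrix $A=(a_{j_1\cdots j_k})\in\mathbb{R}^{d_1\times\dots\times d_k}$, $1\le j_i\le d_i$. There are $k$ vectors in each list $\mathbf{u}_p,\mathbf{v}_p,\dots,\mathbf{z}_p$, the $i$-th one lying in $\mathbb{R}^{d_i}$. The outer product $\mathbf{u}\otimes\mathbf{v}\otimes\dots\otimes\mathbf{z}$ is the tensor with $(j_1,\dots,j_k)$ entry $u_{j_1}v_{j_2}\cdots z_{j_k}$. The $E$-norm is $\lVert A\rVert_E=\sum_{j_1,\dots,j_k}\lvert a_{j_1\cdots j_k}\rvert$. $\mathbb{R}_+^n=\{\mathbf{x}\in\mathbb{R}^n\mid \mathbf{x}\ge 0 \text{ entrywise}\}$ and $\Delta^{n-1}=\{\mathbf{x}\in\mathbb{R}_+^n\mid \lVert\mathbf{x}\rVert_1=1\}$ is the unit simplex. *)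

theory Defs
  imports "HOL-Analysis.Analysis" "HOL-Library.FuncSet"
begin

(* Since the order k and the dimensions d 1, ..., d k vary, vectors and tensors are represented
   as functions on explicit index sets (1-based), extended by undefined outside those sets. *)

definition vectors :: "nat \<Rightarrow> (nat \<Rightarrow> real) set" where
  "vectors n = {1..n} \<rightarrow>\<^sub>E UNIV"

definition norm1 :: "nat \<Rightarrow> (nat \<Rightarrow> real) \<Rightarrow> real" where
  "norm1 n x = (\<Sum>j=1..n. \<bar>x j\<bar>)"

definition nonneg_orthant :: "nat \<Rightarrow> (nat \<Rightarrow> real) set" where
  "nonneg_orthant n = {x \<in> vectors n. \<forall>j\<in>{1..n}. 0 \<le> x j}"

(* The argument is the number n of coordinates, so this is the simplex of dimension n - 1. *)
definition unit_simplex :: "nat \<Rightarrow> (nat \<Rightarrow> real) set" where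
  "unit_simplex n = {x \<in> nonneg_orthant n. norm1 n x = 1}"

(* A multi-index (j_1, ..., j_k) is the function J with J i = j_i for 1 \<le> i \<le> k. *)
definition multi_indices :: "nat \<Rightarrow> (nat \<Rightarrow> nat) \<Rightarrow> (nat \<Rightarrow> nat) set" where
  "multi_indices k d = (\<Pi>\<^sub>E i\<in>{1..k}. {1..d i})"

definition tensors :: "nat \<Rightarrow> (nat \<Rightarrow> nat) \<Rightarrow> ((nat \<Rightarrow> nat) \<Rightarrow> real) set" where
  "tensors k d = multi_indices k d \<rightarrow>\<^sub>E UNIV"

definition nonneg_tensor :: "nat \<Rightarrow> (nat \<Rightarrow> nat) \<Rightarrow> ((nat \<Rightarrow> nat) \<Rightarrow> real) \<Rightarrow> bool" where
  "nonneg_tensor k d A \<longleftrightarrow> A \<in> tensors k d \<and> (\<forall>J\<in>multi_indices k d. 0 \<le> A J)"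

definition E_norm :: "nat \<Rightarrow> (nat \<Rightarrow> nat) \<Rightarrow> ((nat \<Rightarrow> nat) \<Rightarrow> real) \<Rightarrow> real" where
  "E_norm k d A = (\<Sum>J\<in>multi_indices k d. \<bar>A J\<bar>)"

(* w i is the i-th tensor factor, a vector with d i coordinates. *)
definition outer_product ::
    "nat \<Rightarrow> (nat \<Rightarrow> nat) \<Rightarrow> (nat \<Rightarrow> nat \<Rightarrow> real) \<Rightarrow> (nat \<Rightarrow> nat) \<Rightarrow> real" where
  "outer_product k d w = (\<lambda>J\<in>multi_indices k d. \<Prod>i=1..k. w i (J i))"

end

theory Submission
  imports Defs
begin

text \<open>
  The error is a continuous function of the weights \<open>\<delta>\<close> and the factors, and each simplex is
  compact, so existence of a minimiser can fail only if some weight escapes to infinity. This cannot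
  happen: a nonnegative rank-one tensor has \<open>E\<close>-norm equal to the product of the 1-norms of its
  factors, so all the tensors being combined are nonnegative of \<open>E\<close>-norm 1, no cancellation takes
  place between them, and their combination has \<open>E\<close>-norm exactly \<open>\<delta>\<^sub>1 + \<dots> + \<delta>\<^sub>r\<close>
  (lemma \<open>sum_weights_le_error\<close>). By the triangle inequality, a choice with some weight above
  \<open>2 * E_norm k d A\<close> is worse than approximating \<open>A\<close> by zero. Hence it suffices to minimise over the
  compact set where every weight lies in \<open>{0..2 * E_norm k d A}\<close>.
\<close>

lemma compact_PiE:
  fixes S :: "'a \<Rightarrow> ('b::topological_space) set"
  assumes "\<And>i. i \<in> I \<Longrightarrow> compact (S i)"
  shows "compact (PiE I S)"
proof -
  \<comment> \<open>The coordinates outside \<open>I\<close> range over a one-point set, so this is a product over all indices,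
    to which Tychonoff's theorem applies.\<close>
  let ?T = "\<lambda>i. if i \<in> I then S i else {undefined}"
  have "PiE I S = PiE UNIV ?T"
    by (auto simp: PiE_def Pi_def extensional_def split: if_splits)
  moreover have "compactin (product_topology (\<lambda>i. euclidean) UNIV) (PiE UNIV ?T)"
    using assms by (auto simp: compactin_PiE)
  ultimately show ?thesis
    by (simp add: euclidean_product_topology)
qed

lemma compact_unit_simplex: "compact (unit_simplex n)"
proof -
  have "unit_simplex n = ({1..n} \<rightarrow>\<^sub>E {0..1}) \<inter> {x. norm1 n x = 1}" (is "_ = ?R")
  proof (intro equalityI subsetI)
    fix x assume x: "x \<in> unit_simplex n"
    have "x j \<le> 1" if "j \<in> {1..n}" for j
      using member_le_sum[of j "{1..n}" "\<lambda>j. \<bar>x j\<bar>"] x that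
      by (auto simp: unit_simplex_def norm1_def)
    then show "x \<in> ?R"
      using x by (auto simp: unit_simplex_def nonneg_orthant_def vectors_def PiE_def)
  qed (auto simp: unit_simplex_def nonneg_orthant_def vectors_def PiE_def Pi_def)
  moreover have "closed {x. norm1 n x = 1}"
    unfolding norm1_def by (intro closed_Collect_eq continuous_intros continuous_on_product_coordinates)
  ultimately show ?thesis
    by (simp add: compact_PiE compact_Int_closed)
qed

lemma unit_simplex_nonempty:
  assumes "0 < n"
  shows "unit_simplex n \<noteq> {}"
proof -
  have "(\<Sum>j=1..n. \<bar>if j = 1 then 1 else 0 :: real\<bar>) = (\<Sum>j=1..n. if j = 1 then 1 else 0)"
    by (rule sum.cong) auto
  then have "(\<lambda>j\<in>{1..n}. if j = 1 then 1 else 0) \<in> unit_simplex n"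
    using assms by (auto simp: unit_simplex_def nonneg_orthant_def vectors_def norm1_def)
  then show ?thesis by blast
qed

text \<open>Expanding the product of the sums \<open>\<bar>w i 1\<bar> + \<dots> + \<bar>w i (d i)\<bar>\<close> gives one monomial
  per multi-index.\<close>
lemma E_norm_outer_product:
  "E_norm k d (outer_product k d w) = (\<Prod>i=1..k. norm1 (d i) (w i))"
proof -
  have "(\<Prod>i=1..k. norm1 (d i) (w i)) = (\<Sum>J\<in>multi_indices k d. \<Prod>i=1..k. \<bar>w i (J i)\<bar>)"
    unfolding norm1_def multi_indices_def by (rule prod_sum_PiE) auto
  then show ?thesis
    by (simp add: E_norm_def outer_product_def abs_prod)
qed

lemma outer_product_nonneg:
  assumes "\<forall>i\<in>{1..k}. w i \<in> unit_simplex (d i)" and "J \<in> multi_indices k d"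
  shows "0 \<le> outer_product k d w J"
  using assms
  by (auto simp: outer_product_def unit_simplex_def nonneg_orthant_def multi_indices_def
      intro!: prod_nonneg)

definition approximation_error ::
    "nat \<Rightarrow> nat \<Rightarrow> (nat \<Rightarrow> nat) \<Rightarrow> ((nat \<Rightarrow> nat) \<Rightarrow> real) \<Rightarrow>
      (nat \<Rightarrow> real) \<Rightarrow> (nat \<Rightarrow> nat \<Rightarrow> nat \<Rightarrow> real) \<Rightarrow> real" where
  "approximation_error k r d A \<delta> w =
    E_norm k d (\<lambda>J\<in>multi_indices k d. A J - (\<Sum>p=1..r. \<delta> p * outer_product k d (w p) J))"

lemma approximation_error_eq:
  "approximation_error k r d A \<delta> w =
    (\<Sum>J\<in>multi_indices k d. \<bar>A J - (\<Sum>p=1..r. \<delta> p * (\<Prod>i=1..k. w p i (J i)))\<bar>)"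
  by (simp add: approximation_error_def E_norm_def outer_product_def)

text \<open>Coercivity in the weights. The absolute values can be dropped because the summands of the
  combination are nonnegative, so the norms of its terms add up.\<close>
lemma sum_weights_le_error:
  assumes \<delta>: "\<delta> \<in> nonneg_orthant r"
    and w: "\<forall>p\<in>{1..r}. \<forall>i\<in>{1..k}. w p i \<in> unit_simplex (d i)"
  shows "(\<Sum>p=1..r. \<delta> p) \<le> E_norm k d A + approximation_error k r d A \<delta> w"
proof -
  let ?M = "multi_indices k d"
  let ?B = "\<lambda>J. \<Sum>p=1..r. \<delta> p * outer_product k d (w p) J"
  have one: "(\<Sum>J\<in>?M. outer_product k d (w p) J) = 1" if p: "p \<in> {1..r}" for p
  proof -
    have "(\<Sum>J\<in>?M. outer_product k d (w p) J) = E_norm k d (outer_product k d (w p))"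
      unfolding E_norm_def using outer_product_nonneg[of k "w p" d] w p by (intro sum.cong) auto
    also have "\<dots> = 1"
      unfolding E_norm_outer_product using w p by (intro prod.neutral) (auto simp: unit_simplex_def)
    finally show ?thesis .
  qed
  have "(\<Sum>p=1..r. \<delta> p) = (\<Sum>p=1..r. \<delta> p * (\<Sum>J\<in>?M. outer_product k d (w p) J))"
    using one by (intro sum.cong) auto
  also have "\<dots> = (\<Sum>J\<in>?M. ?B J)"
    unfolding sum_distrib_left by (rule sum.swap)
  also have "\<dots> \<le> (\<Sum>J\<in>?M. \<bar>A J\<bar> + \<bar>A J - ?B J\<bar>)"
    by (rule sum_mono) linarith
  also have "\<dots> = E_norm k d A + approximation_error k r d A \<delta> w"
    by (simp add: E_norm_def approximation_error_def sum.distrib)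
  finally show ?thesis .
qed

lemma continuous_on_approximation_error:
  "continuous_on S (\<lambda>(\<delta>, w). approximation_error k r d A \<delta> w)"
proof -
  have weight: "continuous_on S (\<lambda>z. fst z p)"
    for p and S :: "((nat \<Rightarrow> real) \<times> (nat \<Rightarrow> nat \<Rightarrow> nat \<Rightarrow> real)) set"
    by (rule continuous_on_product_then_coordinatewise[OF continuous_on_fst[OF continuous_on_id]])
  have factor: "continuous_on S (\<lambda>z. snd z p i j)"
    for p i j and S :: "((nat \<Rightarrow> real) \<times> (nat \<Rightarrow> nat \<Rightarrow> nat \<Rightarrow> real)) set"
    by (rule continuous_on_product_then_coordinatewise[OF continuous_on_product_then_coordinatewise[OF
          continuous_on_product_then_coordinatewise[OF continuous_on_snd[OF continuous_on_id]]]])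
  show ?thesis
    unfolding approximation_error_eq case_prod_beta
    by (intro continuous_intros weight factor)
qed

theorem theorem6p1:
  fixes k r :: nat and d :: "nat \<Rightarrow> nat" and A :: "(nat \<Rightarrow> nat) \<Rightarrow> real"
  assumes "0 < k" and "0 < r" and "\<forall>i\<in>{1..k}. 0 < d i"
    and "nonneg_tensor k d A"
  shows "\<exists>\<delta> w. \<delta> \<in> nonneg_orthant r \<and> (\<forall>p\<in>{1..r}. \<forall>i\<in>{1..k}. w p i \<in> unit_simplex (d i)) \<and>
    E_norm k d (\<lambda>J\<in>multi_indices k d. A J - (\<Sum>p=1..r. \<delta> p * outer_product k d (w p) J)) =
      Inf {E_norm k d (\<lambda>J\<in>multi_indices k d. A J - (\<Sum>p=1..r. \<epsilon> p * outer_product k d (x p) J)) | \<epsilon> x.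
        \<epsilon> \<in> nonneg_orthant r \<and> (\<forall>p\<in>{1..r}. \<forall>i\<in>{1..k}. x p i \<in> unit_simplex (d i))}"
proof -
  let ?C = "2 * E_norm k d A"
  let ?f = "approximation_error k r d A"
  define D :: "(nat \<Rightarrow> real) set" where "D = ({1..r} \<rightarrow>\<^sub>E {0..?C})"
  define W where "W = ({1..r} \<rightarrow>\<^sub>E (\<Pi>\<^sub>E i\<in>{1..k}. unit_simplex (d i)))"
  have C: "0 \<le> ?C"
    by (simp add: E_norm_def sum_nonneg)
  have "compact (D \<times> W)"
    unfolding D_def W_def by (intro compact_Times compact_PiE compact_unit_simplex compact_Icc)
  moreover have zero: "(\<lambda>p\<in>{1..r}. 0) \<in> D"
    using C by (auto simp: D_def)
  moreover have "W \<noteq> {}"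
    using assms(3) unit_simplex_nonempty by (auto simp: W_def PiE_eq_empty_iff)
  ultimately obtain \<delta> w where \<delta>: "\<delta> \<in> D" and w: "w \<in> W"
    and min: "\<And>\<epsilon> x. \<epsilon> \<in> D \<Longrightarrow> x \<in> W \<Longrightarrow> ?f \<delta> w \<le> ?f \<epsilon> x"
    using continuous_attains_inf[OF _ _ continuous_on_approximation_error, of "D \<times> W" k r d A]
    by fastforce
  have feasible: "\<delta> \<in> nonneg_orthant r" "\<forall>p\<in>{1..r}. \<forall>i\<in>{1..k}. w p i \<in> unit_simplex (d i)"
    using \<delta> w by (auto simp: D_def W_def nonneg_orthant_def vectors_def PiE_iff)
  have le: "?f \<delta> w \<le> ?f \<epsilon> x"
    if \<epsilon>: "\<epsilon> \<in> nonneg_orthant r"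
      and x: "\<forall>p\<in>{1..r}. \<forall>i\<in>{1..k}. x p i \<in> unit_simplex (d i)" for \<epsilon> x
  proof (cases "\<forall>p\<in>{1..r}. \<epsilon> p \<le> ?C")
    case True
    \<comment> \<open>Feasibility leaves \<open>x p i\<close> arbitrary at irrelevant indices, whereas \<open>W\<close> requires the value
      \<open>undefined\<close> there.\<close>
    let ?x = "\<lambda>p\<in>{1..r}. \<lambda>i\<in>{1..k}. x p i"
    have "\<epsilon> \<in> D" "?x \<in> W"
      using \<epsilon> x True by (auto simp: D_def W_def nonneg_orthant_def vectors_def PiE_iff)
    then have "?f \<delta> w \<le> ?f \<epsilon> ?x"
      by (rule min)
    also have "?f \<epsilon> ?x = ?f \<epsilon> x"
      by (simp add: approximation_error_eq)
    finally show ?thesis .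
  next
    case False
    then obtain p where p: "p \<in> {1..r}" "?C < \<epsilon> p"
      by force
    have "?f \<delta> w \<le> ?f (\<lambda>p\<in>{1..r}. 0) w"
      using zero w by (rule min)
    also have "\<dots> = E_norm k d A"
      by (simp add: approximation_error_eq E_norm_def)
    also have "\<dots> \<le> \<epsilon> p - E_norm k d A"
      using p by simp
    also have "\<epsilon> p \<le> (\<Sum>p=1..r. \<epsilon> p)"
      using p \<epsilon> by (intro member_le_sum) (auto simp: nonneg_orthant_def)
    also have "(\<Sum>p=1..r. \<epsilon> p) - E_norm k d A \<le> ?f \<epsilon> x"
      using sum_weights_le_error[OF \<epsilon> x, of A] by simp
    finally show ?thesis by simp
  qed
  have "Inf {?f \<epsilon> x | \<epsilon> x. \<epsilon> \<in> nonneg_orthant r \<and>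
      (\<forall>p\<in>{1..r}. \<forall>i\<in>{1..k}. x p i \<in> unit_simplex (d i))} = ?f \<delta> w"
    using feasible le by (intro cInf_eq_minimum) blast+
  then show ?thesis
    using feasible unfolding approximation_error_def by metis
qed

end
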